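(* Let $G$ be a group and $H$ a normal subgroup of $G$. Then there is a natural isomorphism $C_H^G \cong \operatorname{Tr}_H \circ C_G$ of functors from $\mathbf{Set}$ to $G\text{-}\mathbf{Set}$.
   Context: $G\text{-}\mathbf{Set}$ is the category of (left) $G$-sets and $G$-equivariant maps. The functor $C_G\colon \mathbf{Set}\to G\text{-}\mathbf{Set}$ sends a set $X$ to the set $X^G$ of all functions $G\to X$ with $G$-action $(a\phi)(g)=\phi(a^{-1}g)$, and a map $\alpha$ to post-composition with $\alpha$. For a subgroup $H\le G$, the functor $C_H^G\colon \mathbf{Set}\to G\text{-}\mathbf{Set}$ sends a set $X$ to the set of all functions $G/H\to X$ (where $G/H$ is the set of left cosets) with $G$-action $(g\phi)(aH)=\phi(g^{-1}aH)$, and a map $f$ to post-composition with $f$. For a $G$-set $X$, the $H$-trace is $\operatorname{Tr}_H(X)=\bigcup\{\operatorname{im}(\alpha)\mid \alpha\colon G/H\to X \text{ a } G\text{-equivariant map}\}$, a $G$-subset of $X$, where $G/H$ carries the left translation action; $\operatorname{Tr}_H$ acts on equivariant maps by restriction, giving a functor $\operatorname{Tr}_H\colon G\text{-}\mathbf{Set}\to G\text{-}\mathbf{Set}$. *)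

theory Defs
  imports "HOL-Algebra.Group_Action" "HOL-Algebra.Left_Coset"
begin

section \<open>Categories and functors\<close>

text \<open>
  Arrows carry no domain or codomain of their own, so composition, identities and the arrow part
  of a functor take the objects as explicit arguments: \<open>Comp C X Y Z g f\<close> is the composite of
  \<open>f : X \<rightarrow> Y\<close> and \<open>g : Y \<rightarrow> Z\<close>.
\<close>

record ('o, 'a) category =
  Ob :: "'o set"
  Hom :: "'o \<Rightarrow> 'o \<Rightarrow> 'a set"
  Id :: "'o \<Rightarrow> 'a"
  Comp :: "'o \<Rightarrow> 'o \<Rightarrow> 'o \<Rightarrow> 'a \<Rightarrow> 'a \<Rightarrow> 'a"

definition is_category :: "('o, 'a) category \<Rightarrow> bool" where
  "is_category C \<longleftrightarrow>
     (\<forall>X\<in>Ob C. Id C X \<in> Hom C X X) \<and>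
     (\<forall>X\<in>Ob C. \<forall>Y\<in>Ob C. \<forall>Z\<in>Ob C. \<forall>f\<in>Hom C X Y. \<forall>g\<in>Hom C Y Z. Comp C X Y Z g f \<in> Hom C X Z) \<and>
     (\<forall>X\<in>Ob C. \<forall>Y\<in>Ob C. \<forall>f\<in>Hom C X Y.
        Comp C X X Y f (Id C X) = f \<and> Comp C X Y Y (Id C Y) f = f) \<and>
     (\<forall>W\<in>Ob C. \<forall>X\<in>Ob C. \<forall>Y\<in>Ob C. \<forall>Z\<in>Ob C.
        \<forall>f\<in>Hom C W X. \<forall>g\<in>Hom C X Y. \<forall>h\<in>Hom C Y Z.
        Comp C W Y Z h (Comp C W X Y g f) = Comp C W X Z (Comp C X Y Z h g) f)"

record ('o, 'a, 'p, 'b) fctor =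
  fob :: "'o \<Rightarrow> 'p"
  farr :: "'o \<Rightarrow> 'o \<Rightarrow> 'a \<Rightarrow> 'b"

definition is_functor ::
    "('o, 'a) category \<Rightarrow> ('p, 'b) category \<Rightarrow> ('o, 'a, 'p, 'b) fctor \<Rightarrow> bool" where
  "is_functor C D F \<longleftrightarrow>
     is_category C \<and> is_category D \<and>
     (\<forall>X\<in>Ob C. fob F X \<in> Ob D) \<and>
     (\<forall>X\<in>Ob C. \<forall>Y\<in>Ob C. \<forall>f\<in>Hom C X Y. farr F X Y f \<in> Hom D (fob F X) (fob F Y)) \<and>
     (\<forall>X\<in>Ob C. farr F X X (Id C X) = Id D (fob F X)) \<and>
     (\<forall>X\<in>Ob C. \<forall>Y\<in>Ob C. \<forall>Z\<in>Ob C. \<forall>f\<in>Hom C X Y. \<forall>g\<in>Hom C Y Z.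
        farr F X Z (Comp C X Y Z g f) =
        Comp D (fob F X) (fob F Y) (fob F Z) (farr F Y Z g) (farr F X Y f))"

definition comp_fctor ::
    "('p, 'b, 'q, 'c) fctor \<Rightarrow> ('o, 'a, 'p, 'b) fctor \<Rightarrow> ('o, 'a, 'q, 'c) fctor"
    (infixr \<open>\<circ>\<^sub>F\<close> 55) where
  "S \<circ>\<^sub>F T = \<lparr>fob = \<lambda>X. fob S (fob T X),
             farr = \<lambda>X Y f. farr S (fob T X) (fob T Y) (farr T X Y f)\<rparr>"


section \<open>The categories of sets and of $G$-sets\<close>

text \<open>
  The objects of \<open>SetCat\<close> are all sets with elements in an arbitrary type \<open>'u\<close>, which plays the
  role of the universe. Functions are extensional (\<open>undefined\<close> outside their domain), so that
  equality of arrows is equality of functions on the domain.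
\<close>

definition SetCat :: "('u set, 'u \<Rightarrow> 'u) category" where
  "SetCat = \<lparr>Ob = UNIV, Hom = (\<lambda>X Y. X \<rightarrow>\<^sub>E Y), Id = (\<lambda>X. \<lambda>x\<in>X. x),
             Comp = (\<lambda>X Y Z g f. compose X g f)\<rparr>"

record ('g, 'x) gset =
  elems :: "'x set"
  act :: "'g \<Rightarrow> 'x \<Rightarrow> 'x"

text \<open>The two \<open>G\<close>-sets may have elements of different types.\<close>

definition gset_hom ::
    "('g, 'm) monoid_scheme \<Rightarrow> ('g, 'x) gset \<Rightarrow> ('g, 'y) gset \<Rightarrow> ('x \<Rightarrow> 'y) set" where
  "gset_hom G A B =
     {f \<in> elems A \<rightarrow>\<^sub>E elems B. \<forall>g\<in>carrier G. \<forall>x\<in>elems A. f (act A g x) = act B g (f x)}"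

definition GSetCat :: "('g, 'm) monoid_scheme \<Rightarrow> (('g, 'x) gset, 'x \<Rightarrow> 'x) category" where
  "GSetCat G = \<lparr>Ob = {A. group_action G (elems A) (act A)}, Hom = gset_hom G,
                Id = (\<lambda>A. \<lambda>x\<in>elems A. x), Comp = (\<lambda>A B C g f. compose (elems A) g f)\<rparr>"

definition gset_iso ::
    "('g, 'm) monoid_scheme \<Rightarrow> ('g, 'x) gset \<Rightarrow> ('g, 'y) gset \<Rightarrow> ('x \<Rightarrow> 'y) set" where
  "gset_iso G A B =
     {f \<in> gset_hom G A B. \<exists>h\<in>gset_hom G B A.
        compose (elems A) h f = (\<lambda>x\<in>elems A. x) \<and> compose (elems B) f h = (\<lambda>y\<in>elems B. y)}"

text \<open>
  Natural isomorphism of two functors \<open>F\<close>, \<open>F'\<close> from \<open>C\<close> to \<open>G\<close>-sets. Functors producing functions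
  on \<open>G\<close> and functions on \<open>G/H\<close> have values in \<open>G\<close>-sets over different HOL types, that is, in
  \<open>GSetCat G\<close> at two different universes. Therefore the components and the naturality square are
  formed with \<open>gset_hom\<close>, \<open>gset_iso\<close> and \<open>compose\<close>, which work across types and at equal types are
  the arrows, isomorphisms and composition of \<open>GSetCat G\<close>.
\<close>

definition gset_natural_iso ::
    "('g, 'm) monoid_scheme \<Rightarrow> ('o, 'a) category \<Rightarrow>
     ('o, 'a, ('g, 'x) gset, 'x \<Rightarrow> 'x) fctor \<Rightarrow> ('o, 'a, ('g, 'y) gset, 'y \<Rightarrow> 'y) fctor \<Rightarrow>
     ('o \<Rightarrow> 'x \<Rightarrow> 'y) \<Rightarrow> bool" where
  "gset_natural_iso G C F F' \<eta> \<longleftrightarrow>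
     is_functor C (GSetCat G) F \<and> is_functor C (GSetCat G) F' \<and>
     (\<forall>X\<in>Ob C. \<eta> X \<in> gset_iso G (fob F X) (fob F' X)) \<and>
     (\<forall>X\<in>Ob C. \<forall>Y\<in>Ob C. \<forall>f\<in>Hom C X Y.
        compose (elems (fob F X)) (\<eta> Y) (farr F X Y f) =
        compose (elems (fob F X)) (farr F' X Y f) (\<eta> X))"

definition gset_naturally_isomorphic ::
    "('g, 'm) monoid_scheme \<Rightarrow> ('o, 'a) category \<Rightarrow>
     ('o, 'a, ('g, 'x) gset, 'x \<Rightarrow> 'x) fctor \<Rightarrow> ('o, 'a, ('g, 'y) gset, 'y \<Rightarrow> 'y) fctor \<Rightarrow> bool"
  where
  "gset_naturally_isomorphic G C F F' \<longleftrightarrow> (\<exists>\<eta>. gset_natural_iso G C F F' \<eta>)"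


section \<open>The functors $C_G$, $C_H^G$ and $\mathrm{Tr}_H$\<close>

text \<open>Actions are restricted to the underlying set because \<^const>\<open>group_action\<close> requires it.\<close>

definition cofree :: "('g, 'm) monoid_scheme \<Rightarrow>
    ('u set, 'u \<Rightarrow> 'u, ('g, 'g \<Rightarrow> 'u) gset, ('g \<Rightarrow> 'u) \<Rightarrow> ('g \<Rightarrow> 'u)) fctor" where
  "cofree G =
     \<lparr>fob = \<lambda>X. \<lparr>elems = carrier G \<rightarrow>\<^sub>E X,
                 act = \<lambda>a. \<lambda>\<phi>\<in>carrier G \<rightarrow>\<^sub>E X. \<lambda>g\<in>carrier G. \<phi> (inv\<^bsub>G\<^esub> a \<otimes>\<^bsub>G\<^esub> g)\<rparr>,
      farr = \<lambda>X Y \<alpha>. \<lambda>\<phi>\<in>carrier G \<rightarrow>\<^sub>E X. compose (carrier G) \<alpha> \<phi>\<rparr>"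

definition cofree_coset :: "('g, 'm) monoid_scheme \<Rightarrow> 'g set \<Rightarrow>
    ('u set, 'u \<Rightarrow> 'u, ('g, 'g set \<Rightarrow> 'u) gset, ('g set \<Rightarrow> 'u) \<Rightarrow> ('g set \<Rightarrow> 'u)) fctor" where
  "cofree_coset G H =
     \<lparr>fob = \<lambda>X. \<lparr>elems = (lcosets\<^bsub>G\<^esub> H) \<rightarrow>\<^sub>E X,
                 act = \<lambda>g. \<lambda>\<phi>\<in>(lcosets\<^bsub>G\<^esub> H) \<rightarrow>\<^sub>E X. \<lambda>K\<in>lcosets\<^bsub>G\<^esub> H. \<phi> (inv\<^bsub>G\<^esub> g <#\<^bsub>G\<^esub> K)\<rparr>,
      farr = \<lambda>X Y f. \<lambda>\<phi>\<in>(lcosets\<^bsub>G\<^esub> H) \<rightarrow>\<^sub>E X. compose (lcosets\<^bsub>G\<^esub> H) f \<phi>\<rparr>"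

definition coset_gset :: "('g, 'm) monoid_scheme \<Rightarrow> 'g set \<Rightarrow> ('g, 'g set) gset" where
  "coset_gset G H = \<lparr>elems = lcosets\<^bsub>G\<^esub> H, act = \<lambda>g. \<lambda>K\<in>lcosets\<^bsub>G\<^esub> H. g <#\<^bsub>G\<^esub> K\<rparr>"

definition trace_set :: "('g, 'm) monoid_scheme \<Rightarrow> 'g set \<Rightarrow> ('g, 'x) gset \<Rightarrow> 'x set" where
  "trace_set G H A = (\<Union>\<alpha>\<in>gset_hom G (coset_gset G H) A. \<alpha> ` elems (coset_gset G H))"

definition trace :: "('g, 'm) monoid_scheme \<Rightarrow> 'g set \<Rightarrow>
    (('g, 'x) gset, 'x \<Rightarrow> 'x, ('g, 'x) gset, 'x \<Rightarrow> 'x) fctor" where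
  "trace G H =
     \<lparr>fob = \<lambda>A. \<lparr>elems = trace_set G H A, act = \<lambda>g. restrict (act A g) (trace_set G H A)\<rparr>,
      farr = \<lambda>A B f. restrict f (trace_set G H A)\<rparr>"

end

theory Submission
  imports Defs
begin

text \<open>
  A \<open>G\<close>-map out of \<open>G/H\<close> is determined by the image of the coset \<open>H\<close>, and when \<open>H\<close> is normal
  every point of \<open>G/H\<close> is fixed by \<open>H\<close>; hence \<open>Tr\<^sub>H\<close> consists of the \<open>H\<close>-fixed points. For the
  cofree \<open>G\<close>-set \<open>X\<^sup>G\<close> these are the functions constant on the right cosets of \<open>H\<close>, which by
  normality are the left cosets, so that precomposition with the projection \<open>G \<rightarrow> G/H\<close> is the
  required natural bijection.
\<close>

section \<open>Group actions\<close>

text \<open>\<open>group_action\<close> asks for a homomorphism into the group of bijections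
  \<open>BijGroup E\<close>. Bijectivity follows from the action laws, because \<open>inv g\<close>
  acts as a two-sided inverse of \<open>g\<close>. Extensionality is part of \<open>ext\<close>
  since the elements of \<open>BijGroup E\<close> are extensional and the homomorphism law is an
  equality of HOL functions.\<close>

lemma group_actionI:
  assumes "group G"
    and ext: "\<And>g. g \<in> carrier G \<Longrightarrow> \<phi> g \<in> E \<rightarrow>\<^sub>E E"
    and one: "\<And>x. x \<in> E \<Longrightarrow> \<phi> \<one>\<^bsub>G\<^esub> x = x"
    and mult: "\<And>g h x. \<lbrakk>g \<in> carrier G; h \<in> carrier G; x \<in> E\<rbrakk> \<Longrightarrow> \<phi> (g \<otimes>\<^bsub>G\<^esub> h) x = \<phi> g (\<phi> h x)"
  shows "group_action G E \<phi>"
proof -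
  interpret group G by fact
  have bij: "\<phi> g \<in> Bij E" if g: "g \<in> carrier G" for g
  proof -
    have "bij_betw (\<phi> g) E E"
    proof (rule bij_betw_byWitness[where f' = "\<phi> (inv\<^bsub>G\<^esub> g)"])
      show "\<forall>x\<in>E. \<phi> (inv\<^bsub>G\<^esub> g) (\<phi> g x) = x"
        using g one by (simp flip: mult)
      show "\<forall>x\<in>E. \<phi> g (\<phi> (inv\<^bsub>G\<^esub> g) x) = x"
        using g one by (simp flip: mult)
      show "\<phi> g ` E \<subseteq> E" "\<phi> (inv\<^bsub>G\<^esub> g) ` E \<subseteq> E"
        using g ext[of g] ext[of "inv\<^bsub>G\<^esub> g"] by auto
    qed
    then show ?thesis
      using ext[OF g] by (auto simp: Bij_def PiE_def)
  qed
  have "\<phi> (g \<otimes>\<^bsub>G\<^esub> h) = compose E (\<phi> g) (\<phi> h)" if "g \<in> carrier G" "h \<in> carrier G" for g h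
  proof (rule extensionalityI[where A = E])
    show "\<phi> (g \<otimes>\<^bsub>G\<^esub> h) \<in> extensional E"
      using ext[of "g \<otimes>\<^bsub>G\<^esub> h"] that by (simp add: PiE_def)
  qed (use that mult in \<open>auto simp: compose_def\<close>)
  then have "\<phi> \<in> hom G (BijGroup E)"
    using bij by (auto simp: hom_def BijGroup_def)
  then show ?thesis
    by (simp add: group_action_def group_hom_def group_hom_axioms_def group_BijGroup is_group)
qed

lemma (in group_action) act_in:
  "\<lbrakk>g \<in> carrier G; x \<in> E\<rbrakk> \<Longrightarrow> \<phi> g x \<in> E"
  by (meson element_image)

lemma (in group_action) act_one:
  "x \<in> E \<Longrightarrow> \<phi> \<one> x = x"
  by (metis id_eq_one restrict_apply')


section \<open>Left cosets\<close>

context group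
begin

lemma lcosetsI: "g \<in> carrier G \<Longrightarrow> g <# H \<in> lcosets H"
  by (auto simp: LCOSETS_def)

lemma lcosetsE:
  assumes "K \<in> lcosets H"
  obtains g where "g \<in> carrier G" "K = g <# H"
  using assms by (auto simp: LCOSETS_def)

lemma lcosets_translate:
  assumes "subgroup H G" "g \<in> carrier G" "K \<in> lcosets H"
  shows "g <# K \<in> lcosets H"
proof -
  obtain a where "a \<in> carrier G" "K = a <# H"
    using assms(3) by (rule lcosetsE)
  then show ?thesis
    using assms subgroup.subset[of H G] by (auto simp: lcos_m_assoc intro: lcosetsI)
qed

lemma lcosets_subset_carrier:
  "\<lbrakk>subgroup H G; K \<in> lcosets H\<rbrakk> \<Longrightarrow> K \<subseteq> carrier G"
  using lcosets_subset_PowG by blast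

text \<open>The chosen element lies in the coset, on which \<open>f\<close> is constant. This makes
  functions on cosets defined through \<open>SOME\<close> computable: it serves both for the orbit
  map of a fixed point and for the inverse of the natural isomorphism.\<close>

lemma lcoset_rep_eq:
  assumes "subgroup H G" "g \<in> carrier G" and "\<And>h. h \<in> H \<Longrightarrow> f (g \<otimes> h) = f g"
  shows "f (SOME k. k \<in> g <# H) = f g"
proof -
  have "g \<in> g <# H"
    using assms lcos_self by blast
  then have "(SOME k. k \<in> g <# H) \<in> g <# H"
    by (rule someI)
  then obtain h where "h \<in> H" "(SOME k. k \<in> g <# H) = g \<otimes> h"
    by (auto simp: l_coset_def)
  then show ?thesis
    using assms(3) by simp
qed

text \<open>Normality places \<open>h \<otimes> g\<close> in the right coset of \<open>g\<close>,
  which equals its left coset. In other words, \<open>H\<close> acts trivially on G/H.\<close>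

lemma normal_lcoset_absorb:
  assumes "H \<lhd> G" "h \<in> H" "g \<in> carrier G"
  shows "(h \<otimes> g) <# H = g <# H"
proof -
  have H: "subgroup H G"
    using assms(1) by (rule normal_imp_subgroup)
  have "h \<otimes> g \<in> H #> g"
    using assms(2) by (auto simp: r_coset_def)
  then have "h \<otimes> g \<in> g <# H"
    using normal.coset_eq[OF assms(1)] assms(3) by blast
  then show ?thesis
    using l_repr_independence[OF _ assms(3) H] by blast
qed

end


section \<open>The categories of sets and of $G$-sets\<close>

lemma is_category_SetCat: "is_category SetCat"
  unfolding is_category_def SetCat_def
  by (auto simp: compose_def restrict_def fun_eq_iff PiE_def Pi_def extensional_def)

text \<open>\<open>compose\<close> is \<open>undefined\<close> off \<open>elems A\<close>, so the
  carrier of \<open>A\<close> must be closed under the action before equivariance can be evaluated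
  at \<open>act A g x\<close>. Asking for closure rather than \<open>group_action\<close> lets the
  lemma apply directly to \<open>coset_gset\<close>.\<close>

lemma gset_hom_compose:
  assumes "f \<in> gset_hom G A B" "k \<in> gset_hom G B C"
    and "\<And>g x. \<lbrakk>g \<in> carrier G; x \<in> elems A\<rbrakk> \<Longrightarrow> act A g x \<in> elems A"
  shows "compose (elems A) k f \<in> gset_hom G A C"
  using assms by (auto simp: gset_hom_def compose_def PiE_iff)

lemma is_category_GSetCat:
  fixes G :: "('g, 'm) monoid_scheme"
  shows "is_category (GSetCat G :: (('g, 'x) gset, 'x \<Rightarrow> 'x) category)"
proof -
  have closed: "act A g x \<in> elems A"
    if "group_action G (elems A) (act A)" "g \<in> carrier G" "x \<in> elems A"
    for A :: "('g, 'x) gset" and g x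
    using that group_action.act_in by fast
  show ?thesis
    unfolding is_category_def GSetCat_def
    apply (simp add: gset_hom_compose closed)
    apply (auto simp: gset_hom_def closed compose_def restrict_def fun_eq_iff PiE_def Pi_def extensional_def)
    done
qed

lemma is_functor_comp:
  assumes "is_functor C D T" "is_functor D E S"
  shows "is_functor C E (S \<circ>\<^sub>F T)"
  using assms unfolding is_functor_def comp_fctor_def by simp

text \<open>The inverse of an equivariant bijection is equivariant: \<open>f\<close> sends
  \<open>act A g (h y)\<close> to \<open>act B g y\<close>, and applying \<open>h\<close> gives the
  claim. Hence a set-theoretic inverse suffices.\<close>

lemma gset_isoI:
  assumes f: "f \<in> gset_hom G A B" and h: "h \<in> elems B \<rightarrow>\<^sub>E elems A"
    and hf: "\<And>x. x \<in> elems A \<Longrightarrow> h (f x) = x" and fh: "\<And>y. y \<in> elems B \<Longrightarrow> f (h y) = y"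
    and closed: "\<And>g x. \<lbrakk>g \<in> carrier G; x \<in> elems A\<rbrakk> \<Longrightarrow> act A g x \<in> elems A"
  shows "f \<in> gset_iso G A B"
proof -
  have "h (act B g y) = act A g (h y)" if g: "g \<in> carrier G" and y: "y \<in> elems B" for g y
  proof -
    have hy: "h y \<in> elems A"
      using h y by auto
    then have "f (act A g (h y)) = act B g y"
      using f g y by (simp add: gset_hom_def fh)
    then show ?thesis
      using hf[OF closed[OF g hy]] by simp
  qed
  then have "h \<in> gset_hom G B A"
    using h by (simp add: gset_hom_def)
  moreover have "compose (elems A) h f = (\<lambda>x\<in>elems A. x)" "compose (elems B) f h = (\<lambda>y\<in>elems B. y)"
    by (simp_all add: compose_def hf fh cong: restrict_cong)
  ultimately show ?thesis
    using f unfolding gset_iso_def by blast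
qed


section \<open>The functors $C_G$, $C_H^G$ and $\mathrm{Tr}_H$\<close>

text \<open>Both \<open>C\<^sub>G\<close> and \<open>C\<^sub>H\<^sup>G\<close> are instances: \<open>P\<close> is \<open>G\<close> or \<open>G/H\<close> with left translation.\<close>

lemma is_functor_function_space:
  fixes P :: "'p set" and m :: "'g \<Rightarrow> 'p \<Rightarrow> 'p"
  assumes "group G"
    and closed: "\<And>g p. \<lbrakk>g \<in> carrier G; p \<in> P\<rbrakk> \<Longrightarrow> m g p \<in> P"
    and one: "\<And>p. p \<in> P \<Longrightarrow> m \<one>\<^bsub>G\<^esub> p = p"
    and mult: "\<And>g h p. \<lbrakk>g \<in> carrier G; h \<in> carrier G; p \<in> P\<rbrakk> \<Longrightarrow> m (g \<otimes>\<^bsub>G\<^esub> h) p = m g (m h p)"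
  shows "is_functor (SetCat :: ('u set, 'u \<Rightarrow> 'u) category) (GSetCat G)
     \<lparr>fob = \<lambda>X. \<lparr>elems = P \<rightarrow>\<^sub>E X, act = \<lambda>a. \<lambda>\<phi>\<in>P \<rightarrow>\<^sub>E X. \<lambda>p\<in>P. \<phi> (m (inv\<^bsub>G\<^esub> a) p)\<rparr>,
      farr = \<lambda>X Y \<alpha>. \<lambda>\<phi>\<in>P \<rightarrow>\<^sub>E X. compose P \<alpha> \<phi>\<rparr>"
proof -
  interpret group G by fact
  define A where "A X a = (\<lambda>\<phi>\<in>P \<rightarrow>\<^sub>E X. \<lambda>p\<in>P. \<phi> (m (inv\<^bsub>G\<^esub> a) p))" for X :: "'u set" and a
  have A_in: "A X a \<phi> \<in> P \<rightarrow>\<^sub>E X" if "a \<in> carrier G" "\<phi> \<in> P \<rightarrow>\<^sub>E X" for X a \<phi>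
    using that closed by (auto simp: A_def)
  have action: "group_action G (P \<rightarrow>\<^sub>E X) (A X)" for X
  proof (rule group_actionI)
    fix g h \<phi> assume gh: "g \<in> carrier G" "h \<in> carrier G" and \<phi>: "\<phi> \<in> P \<rightarrow>\<^sub>E X"
    have "A X g (A X h \<phi>) = (\<lambda>p\<in>P. A X h \<phi> (m (inv\<^bsub>G\<^esub> g) p))"
      using A_in[OF gh(2) \<phi>] by (simp add: A_def)
    \<comment> \<open>Precomposition reverses the order of \<open>g\<close> and \<open>h\<close>,
      and the inverse in the definition of the action reverses it back, which makes this a left
      action.\<close>
    also have "\<dots> = A X (g \<otimes>\<^bsub>G\<^esub> h) \<phi>"
      using gh \<phi> by (simp add: A_def closed mult inv_mult_group cong: restrict_cong)
    finally show "A X (g \<otimes>\<^bsub>G\<^esub> h) \<phi> = A X g (A X h \<phi>)" ..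
  next
    fix \<phi> assume "\<phi> \<in> P \<rightarrow>\<^sub>E X"
    then show "A X \<one>\<^bsub>G\<^esub> \<phi> = \<phi>"
      by (auto simp: A_def one PiE_iff extensional_def fun_eq_iff)
  next
    fix g assume "g \<in> carrier G"
    then show "A X g \<in> (P \<rightarrow>\<^sub>E X) \<rightarrow>\<^sub>E (P \<rightarrow>\<^sub>E X)"
      using A_in by (auto simp: A_def)
  qed fact
  have arr: "(\<lambda>\<phi>\<in>P \<rightarrow>\<^sub>E X. compose P \<alpha> \<phi>) \<in>
      gset_hom G \<lparr>elems = P \<rightarrow>\<^sub>E X, act = A X\<rparr> \<lparr>elems = P \<rightarrow>\<^sub>E Y, act = A Y\<rparr>"
    if "\<alpha> \<in> X \<rightarrow>\<^sub>E Y" for X Y \<alpha>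
  proof -
    have maps: "compose P \<alpha> \<phi> \<in> P \<rightarrow>\<^sub>E Y" if "\<phi> \<in> P \<rightarrow>\<^sub>E X" for \<phi>
      using \<open>\<alpha> \<in> X \<rightarrow>\<^sub>E Y\<close> that by (auto simp: compose_def)
    have "compose P \<alpha> (A X g \<phi>) = A Y g (compose P \<alpha> \<phi>)"
      if "g \<in> carrier G" "\<phi> \<in> P \<rightarrow>\<^sub>E X" for g \<phi>
      using that maps closed by (auto simp: A_def compose_def fun_eq_iff)
    then show ?thesis
      using maps A_in by (auto simp: gset_hom_def)
  qed
  have "compose P (\<lambda>x\<in>X. x) \<phi> = \<phi>" if "\<phi> \<in> P \<rightarrow>\<^sub>E X" for \<phi> and X :: "'u set"
    using that by (auto simp: compose_def PiE_iff extensional_def fun_eq_iff)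
  moreover have "compose P \<alpha> \<phi> \<in> P \<rightarrow>\<^sub>E Y"
    if "\<phi> \<in> P \<rightarrow>\<^sub>E X" "\<alpha> \<in> X \<rightarrow>\<^sub>E Y" for \<phi> \<alpha> and X Y :: "'u set"
    using that by (auto simp: compose_def)
  moreover have "restrict (compose P (compose X \<beta> \<alpha>)) (P \<rightarrow>\<^sub>E X) =
      (\<lambda>\<phi>\<in>P \<rightarrow>\<^sub>E X. compose P \<beta> (compose P \<alpha> \<phi>))"
    for \<alpha> \<beta> :: "'u \<Rightarrow> 'u" and X
    by (auto simp: compose_def fun_eq_iff)
  ultimately show ?thesis
    using action arr
    unfolding is_functor_def
    by (simp only: is_category_SetCat is_category_GSetCat)
      (simp flip: A_def add: SetCat_def GSetCat_def compose_def[of "P \<rightarrow>\<^sub>E _"] cong: restrict_cong)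
qed

lemma is_functor_cofree:
  fixes G :: "('g, 'm) monoid_scheme"
  assumes "group G"
  shows "is_functor (SetCat :: ('u set, 'u \<Rightarrow> 'u) category) (GSetCat G) (cofree G)"
proof -
  interpret group G by fact
  show ?thesis
    unfolding cofree_def by (rule is_functor_function_space) (auto simp: m_assoc assms)
qed

lemma is_functor_cofree_coset:
  assumes "group G" "subgroup H G"
  shows "is_functor SetCat (GSetCat G) (cofree_coset G H)"
proof -
  interpret group G by fact
  show ?thesis
    unfolding cofree_coset_def
    by (rule is_functor_function_space)
      (use assms lcosets_subset_carrier[OF assms(2)] in
        \<open>auto simp: lcosets_translate lcos_mult_one lcos_m_assoc\<close>)
qed

section \<open>The trace as a functor on G-sets\<close>

lemma trace_set_subset: "trace_set G H A \<subseteq> elems A"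
  by (auto simp: trace_set_def gset_hom_def)

lemma coset_gset_act_in:
  assumes "group G" "subgroup H G" "g \<in> carrier G" "K \<in> elems (coset_gset G H)"
  shows "act (coset_gset G H) g K \<in> elems (coset_gset G H)"
  using assms group.lcosets_translate[OF assms(1)] by (simp add: coset_gset_def)

text \<open>Translating \<alpha>(K) by \<open>g\<close> gives \<alpha>(gK), a point in the image of
  the same \<alpha>.\<close>

lemma trace_set_act:
  assumes "group G" "subgroup H G" "g \<in> carrier G" "x \<in> trace_set G H A"
  shows "act A g x \<in> trace_set G H A"
proof -
  obtain \<alpha> K where \<alpha>: "\<alpha> \<in> gset_hom G (coset_gset G H) A"
    and K: "K \<in> elems (coset_gset G H)" and x: "x = \<alpha> K"
    using assms(4) by (auto simp: trace_set_def)
  have "act A g x = \<alpha> (act (coset_gset G H) g K)"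
    using \<alpha> K x assms(3) by (simp add: gset_hom_def)
  then show ?thesis
    using \<alpha> coset_gset_act_in[OF assms(1-3) K] by (auto simp: trace_set_def)
qed

text \<open>Composing a G-map out of G/H with \<open>f\<close> gives another such map. This is what
  lets \<open>trace\<close> act on arrows by restriction.\<close>

lemma trace_set_hom:
  assumes "group G" "subgroup H G" "f \<in> gset_hom G A B" "x \<in> trace_set G H A"
  shows "f x \<in> trace_set G H B"
proof -
  obtain \<alpha> K where \<alpha>: "\<alpha> \<in> gset_hom G (coset_gset G H) A"
    and K: "K \<in> elems (coset_gset G H)" and x: "x = \<alpha> K"
    using assms(4) by (auto simp: trace_set_def)
  have "compose (elems (coset_gset G H)) f \<alpha> \<in> gset_hom G (coset_gset G H) B"
    using \<alpha> assms(3) coset_gset_act_in[OF assms(1,2)] by (rule gset_hom_compose)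
  moreover have "f x = compose (elems (coset_gset G H)) f \<alpha> K"
    using K x by (simp add: compose_def)
  ultimately show ?thesis
    using K by (auto simp: trace_set_def)
qed

lemma is_functor_trace:
  fixes G :: "('g, 'm) monoid_scheme"
  assumes "group G" "subgroup H G"
  shows "is_functor (GSetCat G :: (('g, 'x) gset, 'x \<Rightarrow> 'x) category) (GSetCat G) (trace G H)"
proof -
  have action: "group_action G (trace_set G H A) (\<lambda>g. restrict (act A g) (trace_set G H A))"
    if "group_action G (elems A) (act A)" for A :: "('g, 'x) gset"
  proof -
    interpret group_action G "elems A" "act A" by fact
    show ?thesis
      using trace_set_subset[of G H A]
      by (intro group_actionI)
        (auto simp: assms trace_set_act subset_iff act_one composition_rule)
  qed
  have arr: "restrict f (trace_set G H A) \<in> gset_hom G (fob (trace G H) A) (fob (trace G H) B)"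
    if "f \<in> gset_hom G A B" for f and A B :: "('g, 'x) gset"
    using that trace_set_subset[of G H A] trace_set_hom[OF assms that]
    by (auto simp: trace_def gset_hom_def subset_iff trace_set_act assms)
  have "restrict (\<lambda>x\<in>elems A. x) (trace_set G H A) = (\<lambda>x\<in>trace_set G H A. x)"
    for A :: "('g, 'x) gset"
    using trace_set_subset[of G H A] by (auto simp: fun_eq_iff)
  \<comment> \<open>Restricting \<open>k\<close> as well changes nothing, because \<open>f\<close>
    carries the trace of \<open>A\<close> into that of \<open>B\<close>.\<close>
  moreover have "restrict (compose (elems A) k f) (trace_set G H A) =
      compose (trace_set G H A) (restrict k (trace_set G H B)) (restrict f (trace_set G H A))"
    if "f \<in> gset_hom G A B" for f and k :: "'x \<Rightarrow> 'x" and A B :: "('g, 'x) gset"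
    using trace_set_subset[of G H A] trace_set_hom[OF assms that]
    by (auto simp: fun_eq_iff compose_def)
  ultimately show ?thesis
    using action arr
    unfolding is_functor_def
    by (simp only: is_category_GSetCat) (simp add: GSetCat_def trace_def)
qed

section \<open>Traces along a normal subgroup as fixed points\<close>

text \<open>Each point \<alpha>(gH) is fixed by \<open>H\<close>, since hgH = gH by normality.
  Conversely, a fixed point x is the value at the coset \<open>H\<close> of the orbit map sending gH
  to gx.\<close>

lemma trace_set_normal:
  assumes "H \<lhd> G" "group_action G (elems A) (act A)"
  shows "trace_set G H A = {x \<in> elems A. \<forall>h\<in>H. act A h x = x}"
proof -
  interpret normal H G by fact
  interpret A: group_action G "elems A" "act A" by fact
  have H: "subgroup H G" by (rule subgroup_axioms)
  have "act A h x = x" if x: "x \<in> trace_set G H A" and h: "h \<in> H" for h x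
  proof -
    obtain \<alpha> K where \<alpha>: "\<alpha> \<in> gset_hom G (coset_gset G H) A"
      and K: "K \<in> lcosets\<^bsub>G\<^esub> H" and x: "x = \<alpha> K"
      using x by (auto simp: trace_set_def coset_gset_def)
    obtain g where g: "g \<in> carrier G" "K = g <#\<^bsub>G\<^esub> H"
      using K by (rule lcosetsE)
    have "act A h x = \<alpha> (h <#\<^bsub>G\<^esub> K)"
      using \<alpha> K x h by (simp add: gset_hom_def coset_gset_def)
    also have "h <#\<^bsub>G\<^esub> K = K"
      using g h normal_lcoset_absorb[OF assms(1)] by (simp add: lcos_m_assoc subset)
    finally show ?thesis
      using x by simp
  qed
  moreover have "x \<in> trace_set G H A"
    if x: "x \<in> elems A" and fixed: "\<And>h. h \<in> H \<Longrightarrow> act A h x = x" for x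
  proof -
    \<comment> \<open>The orbit map of \<open>x\<close>, evaluated at a chosen representative; the
      choice is immaterial because \<open>H\<close> fixes \<open>x\<close>.\<close>
    define \<alpha> where "\<alpha> = (\<lambda>K\<in>lcosets\<^bsub>G\<^esub> H. act A (SOME k. k \<in> K) x)"
    have \<alpha>: "\<alpha> (g <#\<^bsub>G\<^esub> H) = act A g x" if "g \<in> carrier G" for g
      using lcoset_rep_eq[OF H that, where f = "\<lambda>g. act A g x"] that x fixed
      by (simp add: \<alpha>_def lcosetsI A.composition_rule)
    have "\<alpha> \<in> gset_hom G (coset_gset G H) A"
    proof -
      have "\<alpha> \<in> lcosets\<^bsub>G\<^esub> H \<rightarrow>\<^sub>E elems A"
      proof
        fix K assume "K \<in> lcosets\<^bsub>G\<^esub> H"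
        then obtain g where "g \<in> carrier G" "K = g <#\<^bsub>G\<^esub> H"
          by (rule lcosetsE)
        then show "\<alpha> K \<in> elems A"
          using \<alpha> A.act_in x by simp
      qed (simp add: \<alpha>_def)
      moreover have "\<alpha> (a <#\<^bsub>G\<^esub> K) = act A a (\<alpha> K)"
        if a: "a \<in> carrier G" and K: "K \<in> lcosets\<^bsub>G\<^esub> H" for a K
      proof -
        obtain g where "g \<in> carrier G" "K = g <#\<^bsub>G\<^esub> H"
          using K by (rule lcosetsE)
        then show ?thesis
          using a x by (simp add: \<alpha> lcos_m_assoc subset A.composition_rule)
      qed
      ultimately show ?thesis
        by (simp add: gset_hom_def coset_gset_def)
    qed
    moreover have "x = \<alpha> (\<one>\<^bsub>G\<^esub> <#\<^bsub>G\<^esub> H)"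
      using x by (simp add: \<alpha> A.act_one)
    ultimately show ?thesis
      using lcosetsI[OF one_closed, of H] by (auto simp: trace_set_def coset_gset_def)
  qed
  ultimately show ?thesis
    using trace_set_subset[of G H A] by blast
qed

text \<open>Being fixed by \<open>H\<close> means being invariant under left multiplication by
  \<open>H\<close>. Conjugation in the normal subgroup turns this into invariance under right
  multiplication, the form needed to factor through left cosets.\<close>

lemma trace_set_cofree:
  fixes G :: "('g, 'm) monoid_scheme" and X :: "'u set"
  assumes "H \<lhd> G"
  shows "trace_set G H (fob (cofree G) X) =
    {\<phi> \<in> carrier G \<rightarrow>\<^sub>E X. \<forall>g\<in>carrier G. \<forall>h\<in>H. \<phi> (g \<otimes>\<^bsub>G\<^esub> h) = \<phi> g}"
proof -
  interpret normal H G by fact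
  have action: "group_action G (elems (fob (cofree G) X)) (act (fob (cofree G) X))"
    using is_functor_cofree[OF is_group, where 'u = 'u]
    by (simp add: is_functor_def SetCat_def GSetCat_def)
  have "(\<forall>h\<in>H. (\<lambda>g\<in>carrier G. \<phi> (inv\<^bsub>G\<^esub> h \<otimes>\<^bsub>G\<^esub> g)) = \<phi>) \<longleftrightarrow>
      (\<forall>g\<in>carrier G. \<forall>h\<in>H. \<phi> (g \<otimes>\<^bsub>G\<^esub> h) = \<phi> g)" (is "?L \<longleftrightarrow> ?R")
    if \<phi>: "\<phi> \<in> carrier G \<rightarrow>\<^sub>E X" for \<phi>
  proof
    assume L: ?L
    have inv: "\<phi> (inv\<^bsub>G\<^esub> h \<otimes>\<^bsub>G\<^esub> g) = \<phi> g" if "h \<in> H" "g \<in> carrier G" for g h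
      using L that by (metis restrict_apply')
    show ?R
    proof (intro ballI)
      fix g h assume g: "g \<in> carrier G" and h: "h \<in> H"
      \<comment> \<open>Chosen so that left multiplication of \<open>g\<close> by the inverse of
        \<open>h'\<close> is right multiplication by \<open>h\<close>.\<close>
      define h' where "h' = inv\<^bsub>G\<^esub> (g \<otimes>\<^bsub>G\<^esub> h \<otimes>\<^bsub>G\<^esub> inv\<^bsub>G\<^esub> g)"
      have "h' \<in> H"
        using g h by (simp add: h'_def inv_op_closed2)
      moreover have "inv\<^bsub>G\<^esub> h' \<otimes>\<^bsub>G\<^esub> g = g \<otimes>\<^bsub>G\<^esub> h"
        using g h by (simp add: h'_def m_assoc)
      ultimately show "\<phi> (g \<otimes>\<^bsub>G\<^esub> h) = \<phi> g"
        using inv[of h' g] g by simp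
    qed
  next
    assume R: ?R
    have "\<phi> (inv\<^bsub>G\<^esub> h \<otimes>\<^bsub>G\<^esub> g) = \<phi> g" if g: "g \<in> carrier G" and h: "h \<in> H" for g h
    proof -
      \<comment> \<open>The opposite conjugation moves the inverse of \<open>h\<close> from the left
        of \<open>g\<close> to its right.\<close>
      have "inv\<^bsub>G\<^esub> g \<otimes>\<^bsub>G\<^esub> inv\<^bsub>G\<^esub> h \<otimes>\<^bsub>G\<^esub> g \<in> H"
        using g h by (simp add: inv_op_closed1)
      moreover have "inv\<^bsub>G\<^esub> h \<otimes>\<^bsub>G\<^esub> g = g \<otimes>\<^bsub>G\<^esub> (inv\<^bsub>G\<^esub> g \<otimes>\<^bsub>G\<^esub> inv\<^bsub>G\<^esub> h \<otimes>\<^bsub>G\<^esub> g)"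
        using g h by (simp add: m_assoc[symmetric])
      ultimately show ?thesis
        using R g by metis
    qed
    then show ?L
      using \<phi> by (auto simp: fun_eq_iff PiE_iff extensional_def)
  qed
  then show ?thesis
    unfolding trace_set_normal[OF assms action] by (auto simp: cofree_def)
qed

section \<open>The natural isomorphism\<close>

theorem proposition20:
  fixes G :: "('g, 'm) monoid_scheme" and H :: "'g set"
  assumes "group G" and "H \<lhd> G"
  shows "gset_naturally_isomorphic G (SetCat :: ('u set, 'u \<Rightarrow> 'u) category)
           (cofree_coset G H) (trace G H \<circ>\<^sub>F cofree G)"
proof -
  interpret normal H G by fact
  have H: "subgroup H G" by (rule subgroup_axioms)
  let ?L = "lcosets\<^bsub>G\<^esub> H"
  define T where "T X = trace_set G H (fob (cofree G) X)" for X :: "'u set"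
  have T_iff: "\<phi> \<in> T X \<longleftrightarrow>
      \<phi> \<in> carrier G \<rightarrow>\<^sub>E X \<and> (\<forall>g\<in>carrier G. \<forall>h\<in>H. \<phi> (g \<otimes>\<^bsub>G\<^esub> h) = \<phi> g)" for X \<phi>
    by (simp add: T_def trace_set_cofree[OF assms(2)])
  define \<eta> where "\<eta> X = (\<lambda>\<psi>\<in>?L \<rightarrow>\<^sub>E X. \<lambda>g\<in>carrier G. \<psi> (g <#\<^bsub>G\<^esub> H))" for X :: "'u set"
  \<comment> \<open>The inverse of \<open>\<eta> X\<close>: a function constant on left cosets
    descends to G/H by evaluation at any representative.\<close>
  define \<theta> where "\<theta> X = (\<lambda>\<phi>\<in>T X. \<lambda>K\<in>?L. \<phi> (SOME k. k \<in> K))" for X :: "'u set"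
  have functor1: "is_functor SetCat (GSetCat G) (cofree_coset G H)"
    using is_group H by (rule is_functor_cofree_coset)
  have functor2: "is_functor SetCat (GSetCat G) (trace G H \<circ>\<^sub>F cofree G)"
    by (rule is_functor_comp[OF is_functor_cofree[OF is_group] is_functor_trace[OF is_group H]])
  have absorb: "(g \<otimes>\<^bsub>G\<^esub> h) <#\<^bsub>G\<^esub> H = g <#\<^bsub>G\<^esub> H" if "g \<in> carrier G" "h \<in> H" for g h
    using that coset_join3[OF _ H] by (simp add: lcos_m_assoc[symmetric] subset)
  have \<eta>_in: "\<eta> X \<psi> \<in> T X" if "\<psi> \<in> ?L \<rightarrow>\<^sub>E X" for X \<psi>
    using that by (auto simp: T_iff \<eta>_def absorb lcosetsI)
  have \<theta>_eq: "\<theta> X \<phi> (g <#\<^bsub>G\<^esub> H) = \<phi> g" if "\<phi> \<in> T X" "g \<in> carrier G" for X \<phi> g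
    using that lcoset_rep_eq[OF H, of g \<phi>] by (simp add: \<theta>_def T_iff lcosetsI)
  have \<theta>_in: "\<theta> X \<phi> \<in> ?L \<rightarrow>\<^sub>E X" if \<phi>: "\<phi> \<in> T X" for X \<phi>
  proof
    fix K assume "K \<in> ?L"
    then obtain g where "g \<in> carrier G" "K = g <#\<^bsub>G\<^esub> H"
      by (rule lcosetsE)
    then show "\<theta> X \<phi> K \<in> X"
      using \<theta>_eq[OF \<phi>] \<phi> by (auto simp: T_iff)
  qed (use \<phi> in \<open>simp add: \<theta>_def\<close>)
  \<comment> \<open>The action of \<open>cofree G\<close> is already restricted to all functions on
    G; cutting it down to the smaller set \<open>T X\<close> leaves a single restriction.\<close>
  have target: "fob (trace G H \<circ>\<^sub>F cofree G) X =
      \<lparr>elems = T X, act = \<lambda>a. \<lambda>\<phi>\<in>T X. \<lambda>g\<in>carrier G. \<phi> (inv\<^bsub>G\<^esub> a \<otimes>\<^bsub>G\<^esub> g)\<rparr>" for X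
  proof -
    have "restrict (act (fob (cofree G) X) a) (T X) =
        (\<lambda>\<phi>\<in>T X. \<lambda>g\<in>carrier G. \<phi> (inv\<^bsub>G\<^esub> a \<otimes>\<^bsub>G\<^esub> g))" for a
      by (rule restrict_ext) (simp add: T_iff cofree_def)
    then show ?thesis
      by (simp add: comp_fctor_def trace_def T_def)
  qed
  have \<eta>_fun: "\<eta> X \<in> (?L \<rightarrow>\<^sub>E X) \<rightarrow>\<^sub>E T X" for X
    using \<eta>_in by (simp add: PiE_iff \<eta>_def)
  have \<theta>_fun: "\<theta> X \<in> T X \<rightarrow>\<^sub>E (?L \<rightarrow>\<^sub>E X)" for X
    using \<theta>_in by (simp add: PiE_iff[of _ "T X"] \<theta>_def)
  have iso: "\<eta> X \<in> gset_iso G (fob (cofree_coset G H) X) (fob (trace G H \<circ>\<^sub>F cofree G) X)" for X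
  proof (rule gset_isoI)
    \<comment> \<open>Equivariance of \<open>\<eta> X\<close>, which holds because the projection
      onto G/H commutes with left translation.\<close>
    have "\<eta> X (\<lambda>K\<in>?L. \<psi> (inv\<^bsub>G\<^esub> a <#\<^bsub>G\<^esub> K)) = (\<lambda>g\<in>carrier G. \<eta> X \<psi> (inv\<^bsub>G\<^esub> a \<otimes>\<^bsub>G\<^esub> g))"
      if "a \<in> carrier G" and \<psi>: "\<psi> \<in> ?L \<rightarrow>\<^sub>E X" for a \<psi>
    proof -
      have "(\<lambda>K\<in>?L. \<psi> (inv\<^bsub>G\<^esub> a <#\<^bsub>G\<^esub> K)) \<in> ?L \<rightarrow>\<^sub>E X"
        using that by (auto simp: lcosets_translate[OF H])
      then show ?thesis
        using that by (auto simp: \<eta>_def fun_eq_iff lcosetsI lcos_m_assoc subset)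
    qed
    then show "\<eta> X \<in> gset_hom G (fob (cofree_coset G H) X) (fob (trace G H \<circ>\<^sub>F cofree G) X)"
      using \<eta>_fun[of X] \<eta>_in[of _ X] by (simp add: gset_hom_def target cofree_coset_def)
    show "\<theta> X \<in> elems (fob (trace G H \<circ>\<^sub>F cofree G) X) \<rightarrow>\<^sub>E elems (fob (cofree_coset G H) X)"
      using \<theta>_fun[of X] by (simp add: target cofree_coset_def)
  next
    fix \<psi> assume "\<psi> \<in> elems (fob (cofree_coset G H) X)"
    then have \<psi>: "\<psi> \<in> ?L \<rightarrow>\<^sub>E X"
      by (simp add: cofree_coset_def)
    show "\<theta> X (\<eta> X \<psi>) = \<psi>"
    proof (rule extensionalityI[where A = ?L])
      fix K assume "K \<in> ?L"
      then obtain g where "g \<in> carrier G" "K = g <#\<^bsub>G\<^esub> H"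
        by (rule lcosetsE)
      then show "\<theta> X (\<eta> X \<psi>) K = \<psi> K"
        using \<theta>_eq[OF \<eta>_in[OF \<psi>]] \<psi> by (simp add: \<eta>_def)
    qed (use \<psi> \<theta>_in[OF \<eta>_in[OF \<psi>]] in \<open>auto simp: PiE_def\<close>)
  next
    fix \<phi> assume "\<phi> \<in> elems (fob (trace G H \<circ>\<^sub>F cofree G) X)"
    then have \<phi>: "\<phi> \<in> T X"
      by (simp add: target)
    show "\<eta> X (\<theta> X \<phi>) = \<phi>"
    proof (rule extensionalityI[where A = "carrier G"])
      fix g assume "g \<in> carrier G"
      then show "\<eta> X (\<theta> X \<phi>) g = \<phi> g"
        using \<theta>_in[OF \<phi>] \<theta>_eq[OF \<phi>] by (simp add: \<eta>_def)
    qed (use \<phi> \<theta>_in[OF \<phi>] in \<open>auto simp: T_iff \<eta>_def PiE_def\<close>)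
  next
    fix a \<psi> assume "a \<in> carrier G" "\<psi> \<in> elems (fob (cofree_coset G H) X)"
    then show "act (fob (cofree_coset G H) X) a \<psi> \<in> elems (fob (cofree_coset G H) X)"
      by (auto simp: cofree_coset_def lcosets_translate[OF H])
  qed
  have natural: "compose (?L \<rightarrow>\<^sub>E X) (\<eta> Y) (farr (cofree_coset G H) X Y f) =
      compose (?L \<rightarrow>\<^sub>E X) (farr (trace G H \<circ>\<^sub>F cofree G) X Y f) (\<eta> X)"
    if f: "f \<in> X \<rightarrow>\<^sub>E Y" for X Y f
  proof -
    \<comment> \<open>Naturality amounts to postcomposition with \<open>f\<close> commuting with
      precomposition with the projection.\<close>
    have "\<eta> Y (compose ?L f \<psi>) = compose (carrier G) f (\<eta> X \<psi>)"
      if \<psi>: "\<psi> \<in> ?L \<rightarrow>\<^sub>E X" for \<psi>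
    proof -
      have "compose ?L f \<psi> \<in> ?L \<rightarrow>\<^sub>E Y"
        using f \<psi> by (auto simp: compose_def)
      then show ?thesis
        using \<psi> by (auto simp: \<eta>_def compose_def fun_eq_iff lcosetsI)
    qed
    \<comment> \<open>The arrow part of \<open>cofree G\<close> is restricted to this function set,
      so membership is needed to evaluate it.\<close>
    moreover have "\<eta> X \<psi> \<in> carrier G \<rightarrow>\<^sub>E X" if "\<psi> \<in> ?L \<rightarrow>\<^sub>E X" for \<psi>
      using \<eta>_in[OF that] by (simp add: T_iff)
    ultimately show ?thesis
      using \<eta>_in[of _ X]
      unfolding compose_def[of "?L \<rightarrow>\<^sub>E X"]
      by (intro restrict_ext)
        (simp add: cofree_coset_def comp_fctor_def trace_def T_def[symmetric],
          simp add: cofree_def)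
  qed
  have "gset_natural_iso G SetCat (cofree_coset G H) (trace G H \<circ>\<^sub>F cofree G) \<eta>"
    using functor1 functor2 iso natural
    by (simp add: gset_natural_iso_def SetCat_def cofree_coset_def)
  then show ?thesis
    unfolding gset_naturally_isomorphic_def by blast
qed

end
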